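(* Let $n\ge 1$, $m\ge 1$, let $\Delta_n=\operatorname{conv}\{e_1,\dots,e_{n+1}\}\subseteq\mathbb{R}^{n+1}$ be the standard $n$-simplex, let $T$ be a triangulation of $\Delta_n$, and let $\lambda_1,\dots,\lambda_m$ be Sperner labelings of $T$ (matching on the original vertices, so that $e_i$ receives label $i$ under every $\lambda_t$). Let $m\cdot\Delta_n=\{x\in\mathbb{R}^{n+1} : x_i\ge 0,\ \sum_i x_i=m\}$, and let $y\in m\cdot\Delta_n$ be a point that is not contained in the convex hull of any $n$ lattice points (points of $\mathbb{Z}^{n+1}$) of $m\cdot\Delta_n$. Then there is a facet ($n$-dimensional simplex) $\sigma$ of $T$ and an ordering $v_1,\dots,v_{n+1}$ of its vertices such that $y\in\operatorname{conv}\{y_1,\dots,y_{n+1}\}$, where $y_i\in m\cdot\Delta_n$ is the lattice point whose $j$-th coordinate equals the number of indices $t\in\{1,\dots,m\}$ with $\lambda_t(v_i)=j$.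
   Context: A triangulation of $\Delta_n$ is a collection of $n$-simplices covering $\Delta_n$ with pairwise disjoint interiors such that any two intersect in a (possibly empty) common face. A Sperner labeling of $T$ is an assignment of a label in $\{1,\dots,n+1\}$ to each vertex of $T$ such that the vertex $e_i$ of $\Delta_n$ gets label $i$ and every vertex of $T$ lying in a face $\operatorname{conv}\{e_i : i\in I\}$ of $\Delta_n$ gets a label in $I$.
   Formalization: The triangulation T is assumed to be a finite collection of simplices, as is usual; for infinite collections meeting the stated definition the claim fails already for n = m = 1. *)

theory Defs
  imports "HOL-Analysis.Analysis"
begin

text \<open>
  The coordinates of \<open>\<real>\<^sup>n\<^sup>+\<^sup>1\<close>, and hence the Sperner labels, are the elements of a finite index
  type \<open>'k\<close> with \<open>CARD('k) = n + 1\<close>.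
\<close>

definition std_simplex_face :: "'k::finite set \<Rightarrow> (real ^ 'k) set"
  where "std_simplex_face I = convex hull ((\<lambda>i. axis i 1) ` I)"

abbreviation std_simplex :: "(real ^ 'k::finite) set"
  where "std_simplex \<equiv> std_simplex_face UNIV"

definition dilated_simplex :: "nat \<Rightarrow> (real ^ 'k::finite) set"
  where "dilated_simplex m = {x. (\<forall>i. 0 \<le> x $ i) \<and> (\<Sum>i\<in>UNIV. x $ i) = real m}"

definition lattice_points :: "(real ^ 'k::finite) set"
  where "lattice_points = {x. \<forall>i. x $ i \<in> \<int>}"

text \<open>
  The library predicate \<^const>\<open>triangulation\<close> contributes finiteness and the requirement that any two
  members meet in a common face. Interiors are relative, since the simplices span only a hyperplane.
\<close>

definition triangulates :: "nat \<Rightarrow> (real ^ 'k::finite) set set \<Rightarrow> (real ^ 'k) set \<Rightarrow> bool"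
  where "triangulates n T P \<longleftrightarrow>
    triangulation T \<and> (\<forall>S\<in>T. int n simplex S) \<and> \<Union>T = P \<and>
    pairwise (\<lambda>S S'. disjnt (rel_interior S) (rel_interior S')) T"

definition vertices :: "(real ^ 'k::finite) set \<Rightarrow> (real ^ 'k) set"
  where "vertices S = {v. v extreme_point_of S}"

text \<open>Only the values of a labeling at the vertices of \<open>T\<close> matter.\<close>

definition sperner_labeling ::
    "(real ^ 'k::finite) set set \<Rightarrow> (real ^ 'k \<Rightarrow> 'k) \<Rightarrow> bool"
  where "sperner_labeling T l \<longleftrightarrow>
    (\<forall>i. l (axis i 1) = i) \<and>
    (\<forall>S\<in>T. \<forall>v\<in>vertices S. \<forall>I. v \<in> std_simplex_face I \<longrightarrow> l v \<in> I)"

definition label_point :: "nat \<Rightarrow> (nat \<Rightarrow> real ^ 'k::finite \<Rightarrow> 'k) \<Rightarrow> real ^ 'k \<Rightarrow> real ^ 'k"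
  where "label_point m L v = (\<chi> j. real (card {t \<in> {1..m}. L t v = j}))"

lemma label_point_in_dilated_simplex: "label_point m L v \<in> dilated_simplex m"
proof -
  have "(\<Sum>j\<in>UNIV. card {t \<in> {1..m}. L t v = j}) = card (\<Union>j. {t \<in> {1..m}. L t v = j})"
    by (rule card_UN_disjoint [symmetric]) auto
  also have "(\<Union>j. {t \<in> {1..m}. L t v = j}) = {1..m}"
    by auto
  finally show ?thesis
    by (simp add: dilated_simplex_def label_point_def flip: of_nat_sum)
qed

lemma label_point_in_lattice_points: "label_point m L v \<in> lattice_points"
  by (simp add: lattice_points_def label_point_def)

end

theory Submission
  imports Defs
begin

text \<open>
  The map that is linear on each simplex of \<open>T\<close> and sends a vertex to its label point is continuous
  and, by the Sperner condition, sends every face of the simplex into the corresponding face of the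
  dilated simplex. Brouwer's theorem makes any such map surjective; the simplex containing a
  preimage of \<open>y\<close> is the required one.
\<close>

text \<open>The barycentric coordinates of a point with respect to the \<open>axis i 1\<close> are
  its own coordinates, so membership in a face becomes the vanishing of coordinates. The basis
  expansion of \<open>x\<close> supplies the convex combination.\<close>

lemma std_simplex_face_iff:
  fixes x :: "real ^ 'k::finite"
  shows "x \<in> std_simplex_face I \<longleftrightarrow>
    (\<forall>i. 0 \<le> x $ i) \<and> (\<Sum>i\<in>UNIV. x $ i) = 1 \<and> (\<forall>i. i \<notin> I \<longrightarrow> x $ i = 0)"
proof
  let ?A = "{x :: real ^ 'k. (\<forall>i. 0 \<le> x $ i) \<and> (\<Sum>i\<in>UNIV. x $ i) = 1 \<and> (\<forall>i. i \<notin> I \<longrightarrow> x $ i = 0)}"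
  have "convex ?A"
    by (rule convexI) (auto simp: sum.distrib simp flip: sum_distrib_left)
  moreover have "(\<lambda>i. axis i 1) ` I \<subseteq> ?A"
    by (auto simp: axis_def if_distrib cong: if_cong)
  ultimately have "std_simplex_face I \<subseteq> ?A"
    unfolding std_simplex_face_def by (rule hull_minimal[rotated])
  then show "x \<in> std_simplex_face I \<Longrightarrow>
    (\<forall>i. 0 \<le> x $ i) \<and> (\<Sum>i\<in>UNIV. x $ i) = 1 \<and> (\<forall>i. i \<notin> I \<longrightarrow> x $ i = 0)"
    by blast
next
  assume x: "(\<forall>i. 0 \<le> x $ i) \<and> (\<Sum>i\<in>UNIV. x $ i) = 1 \<and> (\<forall>i. i \<notin> I \<longrightarrow> x $ i = 0)"
  have sumI: "(\<Sum>i\<in>I. x $ i) = 1"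
    using x by (subst sum.mono_neutral_left[of UNIV]) auto
  have "x = (\<Sum>i\<in>UNIV. x $ i *\<^sub>R axis i 1)"
    using basis_expansion[of x] by (simp add: scalar_mult_eq_scaleR)
  also have "\<dots> = (\<Sum>i\<in>I. x $ i *\<^sub>R axis i 1)"
    using x by (intro sum.mono_neutral_right) auto
  also have "\<dots> \<in> std_simplex_face I"
    unfolding std_simplex_face_def
    using x sumI by (intro convex_sum) (auto intro: hull_inc)
  finally show "x \<in> std_simplex_face I" .
qed

text \<open>Raising the coordinates of \<open>x\<close> in which \<open>f x\<close> falls short of
  \<open>y\<close>, and rescaling, gives a continuous self-map of the simplex. Brouwer provides a
  fixed point, and a fixed point is possible only where \<open>f x = y\<close>.\<close>

lemma face_preserving_map_surj:
  fixes f :: "real ^ 'k::finite \<Rightarrow> real ^ 'k"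
  assumes cont: "continuous_on std_simplex f"
    and maps: "f ` std_simplex \<subseteq> dilated_simplex m"
    and faces: "\<And>x j. x \<in> std_simplex \<Longrightarrow> x $ j = 0 \<Longrightarrow> f x $ j = 0"
    and y: "y \<in> dilated_simplex m"
  shows "y \<in> f ` std_simplex"
proof (rule ccontr)
  assume ny: "y \<notin> f ` std_simplex"
  \<comment> \<open>At a fixed point of \<open>g\<close> the vector \<open>p x\<close> is a nonzero multiple of \<open>x\<close>, so \<open>x\<close> vanishes wherever
    \<open>f x\<close> exceeds \<open>y\<close>, which contradicts face preservation.\<close>
  define p where "p x = (\<chi> i. max 0 (y $ i - f x $ i))" for x
  define s where "s x = (\<Sum>i\<in>UNIV. p x $ i)" for x
  define g where "g x = (1 / (1 + s x)) *\<^sub>R (x + p x)" for x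
  have p_nonneg: "0 \<le> p x $ i" for x i
    by (simp add: p_def)
  have s_nonneg: "0 \<le> s x" for x
    by (simp add: s_def p_nonneg sum_nonneg)
  have s_pos: "1 + s x \<noteq> 0" for x
    using s_nonneg[of x] by linarith
  have "continuous_on std_simplex p"
    unfolding p_def by (intro continuous_intros cont)
  then have "continuous_on std_simplex g"
    unfolding g_def s_def[abs_def]
    by (intro continuous_intros) (use s_pos in \<open>auto simp: s_def\<close>)
  moreover have "g \<in> std_simplex \<rightarrow> std_simplex"
  proof
    fix x :: "real ^ 'k" assume x: "x \<in> std_simplex"
    have "(\<Sum>i\<in>UNIV. g x $ i) = (1 / (1 + s x)) * (1 + s x)"
      using x by (simp add: g_def std_simplex_face_iff s_def sum.distrib
          flip: sum_distrib_left sum_divide_distrib)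
    then show "g x \<in> std_simplex"
      using x s_pos[of x] s_nonneg[of x] p_nonneg[of x]
      by (auto simp: std_simplex_face_iff g_def)
  qed
  moreover have "compact (std_simplex :: (real ^ 'k) set)"
    unfolding std_simplex_face_def by (intro finite_imp_compact_convex_hull) auto
  moreover have "convex (std_simplex :: (real ^ 'k) set)" "(std_simplex :: (real ^ 'k) set) \<noteq> {}"
    unfolding std_simplex_face_def by auto
  ultimately obtain x where x: "x \<in> std_simplex" "g x = x"
    using brouwer[of "std_simplex :: (real ^ 'k) set" g] by metis
  have "x + p x = (1 + s x) *\<^sub>R g x"
    using s_pos[of x] by (simp add: g_def)
  then have px: "p x = s x *\<^sub>R x"
    by (simp add: x(2) algebra_simps)
  \<comment> \<open>Both coordinate sums equal \<open>m\<close>, so two different points differ in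
    both directions: some coordinate \<open>j\<close> of \<open>f x\<close> is too large, where
    \<open>p x\<close> vanishes, and some coordinate \<open>i\<close> is too small, which makes
    \<open>s x\<close> nonzero.\<close>
  have sums: "(\<Sum>i\<in>UNIV. f x $ i) = (\<Sum>i\<in>UNIV. y $ i)"
    using maps x(1) y by (auto simp: dilated_simplex_def)
  have "f x \<noteq> y"
    using ny x(1) by blast
  then obtain j where j: "y $ j < f x $ j"
    using sum_mono_inv[OF sums] by (metis finite_class.finite_UNIV UNIV_I not_le vec_eq_iff)
  obtain i where i: "f x $ i < y $ i"
    using \<open>f x \<noteq> y\<close> sum_mono_inv[OF sums[symmetric]]
    by (metis finite_class.finite_UNIV UNIV_I not_le vec_eq_iff)
  have "s x \<noteq> 0"
    using px i by (auto simp: p_def vec_eq_iff max_def dest!: spec[of _ i])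
  moreover have "p x $ j = 0"
    using j by (simp add: p_def)
  ultimately have "x $ j = 0"
    using px by simp
  then have "f x $ j = 0"
    using faces x(1) by blast
  moreover have "0 \<le> y $ j"
    using y by (simp add: dilated_simplex_def)
  ultimately show False
    using j by simp
qed

text \<open>Such a vertex lies in the face opposite to \<open>axis j 1\<close>, so the Sperner
  condition for \<open>- {j}\<close> forbids the label \<open>j\<close> in every labeling and the
  count is zero.\<close>

lemma label_point_eq_0:
  assumes "\<And>t. t \<in> {1..m} \<Longrightarrow> sperner_labeling T (L t)"
    and "S \<in> T" "v \<in> vertices S" "v \<in> std_simplex" "v $ j = 0"
  shows "label_point m L v $ j = 0"
proof -
  have "v \<in> std_simplex_face (- {j})"
    using assms(4,5) by (simp add: std_simplex_face_iff)
  then have "L t v \<noteq> j" if "t \<in> {1..m}" for t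
    using assms(1)[OF that] assms(2,3) by (fastforce simp: sperner_labeling_def)
  then show ?thesis
    by (auto simp: label_point_def)
qed

lemma convex_dilated_simplex: "convex (dilated_simplex m)"
  unfolding dilated_simplex_def
  by (rule convexI) (auto simp: sum.distrib simp flip: sum_distrib_left distrib_right)

text \<open>Applying \<open>\<phi>\<close> to a linear relation shows that its coefficients sum to
  zero, which makes it an affine relation.\<close>

lemma affine_independent_imp_independent:
  fixes C :: "'a::euclidean_space set"
  assumes "\<not> affine_dependent C" and "linear \<phi>" and "\<And>v. v \<in> C \<Longrightarrow> \<phi> v = (1::real)"
  shows "independent C"
proof
  assume "dependent C"
  have fin: "finite C"
    using assms(1) by (rule aff_independent_finite)
  then obtain u v where u: "(\<Sum>v\<in>C. u v *\<^sub>R v) = 0" and v: "v \<in> C" "u v \<noteq> 0"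
    using \<open>dependent C\<close> by (auto simp: dependent_finite)
  have "0 = \<phi> (\<Sum>v\<in>C. u v *\<^sub>R v)"
    by (simp add: u linear_0[OF assms(2)])
  also have "\<dots> = sum u C"
    using assms(3) by (simp add: linear_sum[OF assms(2)] linear_cmul[OF assms(2)])
  finally have "affine_dependent C"
    using u v fin by (auto simp: affine_dependent_explicit_finite)
  with assms(1) show False ..
qed

text \<open>The predicate \<open>simplex\<close> only asserts that some affinely independent
  generating set exists; affine independence identifies that set with the extreme points.\<close>

lemma simplex_eq_convex_hull_vertices:
  fixes S :: "(real ^ 'k::finite) set"
  assumes "d simplex S"
  shows "S = convex hull (vertices S)" and "\<not> affine_dependent (vertices S)"
    and "int (card (vertices S)) = d + 1"
proof -
  obtain C where C: "\<not> affine_dependent C" "int (card C) = d + 1" "S = convex hull C"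
    using assms by (auto simp: simplex_def)
  have "vertices S = C"
    using C by (auto simp: vertices_def extreme_point_of_convex_hull_affine_independent)
  then show "S = convex hull (vertices S)" "\<not> affine_dependent (vertices S)"
    "int (card (vertices S)) = d + 1"
    using C by auto
qed

theorem theorem2:
  fixes n m :: nat
    and T :: "(real ^ 'k::finite) set set"
    and L :: "nat \<Rightarrow> real ^ 'k \<Rightarrow> 'k"
    and y :: "real ^ 'k"
  assumes "n \<ge> 1" and "m \<ge> 1"
    and "CARD('k) = n + 1"
    and "triangulates n T std_simplex"
    and "\<And>t. t \<in> {1..m} \<Longrightarrow> sperner_labeling T (L t)"
    and "y \<in> dilated_simplex m"
    and "\<And>P. P \<subseteq> lattice_points \<inter> dilated_simplex m \<Longrightarrow> card P = n \<Longrightarrow> y \<notin> convex hull P"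
  shows "\<exists>\<sigma>\<in>T. \<exists>v :: nat \<Rightarrow> real ^ 'k.
    bij_betw v {1..n + 1} (vertices \<sigma>) \<and>
    y \<in> convex hull ((\<lambda>i. label_point m L (v i)) ` {1..n + 1})"
proof -
  let ?p = "label_point m L"
  have finT: "finite T" and UT: "\<Union>T = std_simplex"
    and simp: "\<And>S. S \<in> T \<Longrightarrow> int n simplex S"
    and face: "\<And>S S'. S \<in> T \<Longrightarrow> S' \<in> T \<Longrightarrow> S \<inter> S' face_of S"
    using assms(4) by (auto simp: triangulates_def triangulation_def)
  have hull: "S = convex hull (vertices S)" and aff: "\<not> affine_dependent (vertices S)"
    and card: "card (vertices S) = n + 1" if "S \<in> T" for S
    using simplex_eq_convex_hull_vertices[OF simp[OF that]] by auto
  have finV: "finite (vertices S)" if "S \<in> T" for S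
    using aff[OF that] by (rule aff_independent_finite)
  have V: "v \<in> std_simplex" if "S \<in> T" "v \<in> vertices S" for S v
    using that UT by (auto simp: vertices_def extreme_point_of_def)
  \<comment> \<open>The coordinate sum is 1 on the whole simplex, hence at all vertices. This makes
    the vertices of each \<open>S\<close> linearly independent, so the label points extend to a
    linear map \<open>h S\<close> on the whole space and no affine map is needed.\<close>
  have sum_linear: "linear (\<lambda>x :: real ^ 'k. \<Sum>i\<in>UNIV. x $ i)"
    by (rule linearI) (simp_all add: sum.distrib sum_distrib_left)
  have "independent (vertices S)" if "S \<in> T" for S
    by (rule affine_independent_imp_independent[OF aff[OF that] sum_linear])
      (use V[OF that] in \<open>simp add: std_simplex_face_iff\<close>)
  then have "\<forall>S\<in>T. \<exists>h. linear h \<and> (\<forall>v\<in>vertices S. h v = ?p v)"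
    by (blast intro: linear_independent_extend)
  then obtain h where lin: "\<And>S. S \<in> T \<Longrightarrow> linear (h S)"
    and h: "\<And>S v. S \<in> T \<Longrightarrow> v \<in> vertices S \<Longrightarrow> h S v = ?p v"
    by metis
  \<comment> \<open>The common face is spanned by its own vertices, which are vertices of both
    simplices, and there both linear maps take the label points as values.\<close>
  have agree: "h S x = h S' x" if S: "S \<in> T" and S': "S' \<in> T" and x: "x \<in> S \<inter> S'" for S S' x
  proof -
    have "polytope S"
      using simp[OF S] by (rule simplex_imp_polytope)
    then have "polytope (S \<inter> S')"
      using face[OF S S'] face_of_polytope_polytope by blast
    then have "S \<inter> S' = convex hull (vertices (S \<inter> S'))"
      unfolding vertices_def
      by (intro Krein_Milman_Minkowski) (auto simp: polytope_imp_compact polytope_imp_convex)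
    then have "x \<in> span (vertices (S \<inter> S'))"
      using x convex_hull_subset_span by blast
    moreover have "vertices (S \<inter> S') \<subseteq> vertices S \<inter> vertices S'"
      using extreme_point_of_face[OF face[OF S S']]
        extreme_point_of_face[OF face[OF S' S, unfolded Int_commute[of S' S]]]
      unfolding vertices_def by blast
    ultimately show ?thesis
      using h[OF S] h[OF S'] linear_eq_on_span[OF lin[OF S] lin[OF S']] by (metis IntD1 IntD2 subsetD)
  qed
  \<comment> \<open>By \<open>agree\<close>, the value does not depend on which simplex containing
    \<open>x\<close> is chosen.\<close>
  define f where "f x = h (SOME S. S \<in> T \<and> x \<in> S) x" for x
  have f: "f x = h S x" if "S \<in> T" "x \<in> S" for S x
  proof -
    have "(SOME S. S \<in> T \<and> x \<in> S) \<in> T \<and> x \<in> (SOME S. S \<in> T \<and> x \<in> S)"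
      using that by (intro someI[of "\<lambda>S. S \<in> T \<and> x \<in> S" S]) auto
    then show ?thesis
      unfolding f_def using that agree by blast
  qed
  \<comment> \<open>The same weights express \<open>x\<close> through the vertices and
    \<open>f x\<close> through their label points, since \<open>h S\<close> is linear.\<close>
  have coords: "\<exists>u. (\<forall>v\<in>vertices S. 0 \<le> u v) \<and> sum u (vertices S) = 1 \<and>
      x = (\<Sum>v\<in>vertices S. u v *\<^sub>R v) \<and> f x = (\<Sum>v\<in>vertices S. u v *\<^sub>R ?p v)"
    if S: "S \<in> T" and x: "x \<in> S" for S x
  proof -
    have "x \<in> convex hull (vertices S)"
      using x hull[OF S] by metis
    then obtain u where u: "\<forall>v\<in>vertices S. 0 \<le> u v" "sum u (vertices S) = 1"
      "(\<Sum>v\<in>vertices S. u v *\<^sub>R v) = x"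
      unfolding convex_hull_finite[OF finV[OF S]] by blast
    have "f x = h S (\<Sum>v\<in>vertices S. u v *\<^sub>R v)"
      by (simp add: f[OF S x] u(3))
    also have "\<dots> = (\<Sum>v\<in>vertices S. u v *\<^sub>R ?p v)"
      by (simp add: linear_sum[OF lin[OF S]] linear_cmul[OF lin[OF S]] h[OF S])
    finally show ?thesis
      using u(1,2) u(3)[symmetric] by (intro exI[of _ u] conjI)
  qed
  have f_hull: "f x \<in> convex hull (?p ` vertices S)" if S: "S \<in> T" and x: "x \<in> S" for S x
  proof -
    obtain u where u: "\<forall>v\<in>vertices S. 0 \<le> u v" "sum u (vertices S) = 1"
      "f x = (\<Sum>v\<in>vertices S. u v *\<^sub>R ?p v)"
      using coords[OF S x] by blast
    show ?thesis
      unfolding u(3) using u(1,2) by (intro convex_sum finV[OF S]) (auto intro: hull_inc)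
  qed
  have "y \<in> f ` std_simplex"
  proof (rule face_preserving_map_surj[OF _ _ _ assms(6)])
    have "closed S" "continuous_on S f" if "S \<in> T" for S
    proof -
      show "closed S"
        using polytope_imp_closed simplex_imp_polytope simp that by blast
      have "continuous_on S (h S)"
        using lin[OF that] by (simp add: linear_continuous_on linear_linear)
      then show "continuous_on S f"
        using f[OF that] by (simp cong: continuous_on_cong)
    qed
    \<comment> \<open>Pasting: \<open>f\<close> is continuous on each of finitely many closed
      simplices that cover the domain.\<close>
    then show "continuous_on std_simplex f"
      using continuous_on_closed_Union[OF finT, of "\<lambda>S. S" f] UT by simp
    show "f ` std_simplex \<subseteq> dilated_simplex m"
    proof
      fix z assume "z \<in> f ` std_simplex"
      then obtain S x where "S \<in> T" "x \<in> S" "z = f x"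
        using UT by blast
      moreover have "convex hull (?p ` vertices S) \<subseteq> dilated_simplex m"
        by (intro hull_minimal convex_dilated_simplex) (auto simp: label_point_in_dilated_simplex)
      ultimately show "z \<in> dilated_simplex m"
        using f_hull by blast
    qed
    fix x :: "real ^ 'k" and j assume "x \<in> std_simplex" and xj: "x $ j = 0"
    then obtain S where S: "S \<in> T" "x \<in> S"
      using UT by blast
    obtain u where u: "\<forall>v\<in>vertices S. 0 \<le> u v"
      "x = (\<Sum>v\<in>vertices S. u v *\<^sub>R v)" "f x = (\<Sum>v\<in>vertices S. u v *\<^sub>R ?p v)"
      using coords[OF S] by blast
    \<comment> \<open>A vanishing sum of nonnegative terms: every vertex of nonzero weight has
      \<open>j\<close>-th coordinate 0, hence so does its label point.\<close>
    have "(\<Sum>v\<in>vertices S. u v * v $ j) = 0"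
      using xj u(2) by simp
    moreover have "\<And>v. v \<in> vertices S \<Longrightarrow> 0 \<le> u v * v $ j"
      using u(1) V[OF S(1)] by (simp add: std_simplex_face_iff)
    ultimately have "\<forall>v\<in>vertices S. u v * v $ j = 0"
      using sum_nonneg_eq_0_iff[OF finV[OF S(1)], of "\<lambda>v. u v * v $ j"] by blast
    then have "\<forall>v\<in>vertices S. u v = 0 \<or> ?p v $ j = 0"
      using label_point_eq_0[OF assms(5) S(1) _ V[OF S(1)]] by auto
    then show "f x $ j = 0"
      unfolding u(3) by (auto intro!: sum.neutral)
  qed
  then obtain S x where S: "S \<in> T" "x \<in> S" and y: "y = f x"
    using UT by blast
  \<comment> \<open>Any enumeration of the \<open>n + 1\<close> vertices will do, because the hull
    depends only on the set of label points, even if some of them coincide.\<close>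
  obtain v where v: "bij_betw v {1..n + 1} (vertices S)"
    using finite_same_card_bij[of "{1..n + 1}" "vertices S"] card[OF S(1)] finV[OF S(1)] by auto
  then have "?p ` vertices S = (\<lambda>i. ?p (v i)) ` {1..n + 1}"
    by (simp only: image_image flip: bij_betw_imp_surj_on[OF v])
  then have "y \<in> convex hull ((\<lambda>i. ?p (v i)) ` {1..n + 1})"
    using f_hull[OF S] by (simp only: y)
  with v S(1) show ?thesis
    by blast
qed

end
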